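(* Consider the scheme $$\frac{y^{n+1}-y^n}\tau+A(\sigma y^{n+1}+(1-\sigma)y^n)=\varphi^n,\quad n=0,1,\dots,\qquad y^0=u^0,\qquad A=C+D,$$ on grid functions vanishing on $\partial\omega$, where for $x\in\omega$ $$Dw=-\frac1{h^2}k(x+0.5h)(w(x+h)-w(x))+\frac1{h^2}k(x-0.5h)(w(x)-w(x-h)),$$ and either (nondivergent case) $$Cw=\frac1{2h}v(x+0.5h,t)(w(x+h)-w(x))+\frac1{2h}v(x-0.5h,t)(w(x)-w(x-h)),$$ or (divergent case) $$Cw=\frac1{2h}v(x+0.5h,t)(w(x+h)+w(x))-\frac1{2h}v(x-0.5h,t)(w(x)+w(x-h)).$$ Assume $$\frac{h\,|v(x\pm0.5h,t)|}{k(x\pm0.5h)}\le 2,\qquad x\in\omega .$$ Then the scheme is monotone and its solution satisfies $$\|y^{n+1}\|\le\|u^0\|+\sum_{k=0}^n\tau\|\varphi^k\|$$ in $L_\infty$ in the nondivergent case (respectively, in $L_1$ in the divergent case), for any $\tau>0$ if $\sigma=1$, and, if $0\le\sigma<1$, under the time-step constraint $$\tau\le\frac1{(1-\sigma)\gamma},$$ where $$\gamma=\max_{x\in\omega}\Big(\frac1{h^2}(k(x+0.5h)+k(x-0.5h))-\frac1{2h}(v(x+0.5h,t)-v(x-0.5h,t))\Big)$$ in the nondivergent case, and $$\gamma=\max_{x\in\omega}\Big(\frac1{h^2}(k(x+0.5h)+k(x-0.5h))+\frac1{2h}(v(x+0.5h,t)-v(x-0.5h,t))\Big)$$ in the divergent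 case.
   Context: $\bar\omega=\{ih: i=0,\dots,N\}$, $Nh=l$, $\omega=\{ih: i=1,\dots,N-1\}$, $\partial\omega=\{0,l\}$. $k(x)\ge\kappa_1>0$ and $v(x,t)$ are given real functions on $[0,l]$ and $[0,l]\times[0,T]$. Grid functions are identified with vectors indexed by $\omega$, with $\|w\|_\infty=\max_{x\in\omega}|w(x)|$ and $\|w\|_1=\sum_{x\in\omega}|w(x)|$. $\tau>0$ is the time step, $t^n=n\tau$; in the step from $t^n$ to $t^{n+1}$ the operator $A$ is taken e.g. at $t=\sigma t^{n+1}+(1-\sigma)t^n$, and the conditions involving $t$ are required at these times. If $\gamma=0$ the time-step constraint is void. The scheme is monotone if $u^0\ge0$ and $\varphi^n\ge0$ for all $n$ imply $y^{n+1}\ge0$ for all $n$. *)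

theory Defs
  imports Complex_Main
begin

(* A grid function is a total function on the reals of which only the values at the
   nodes i * h, 0 <= i <= N, are ever used. *)

definition grid :: "real \<Rightarrow> nat \<Rightarrow> real set" where
  "grid h N = (\<lambda>i. real i * h) ` {1..N - 1}"

definition grid_boundary :: "real \<Rightarrow> nat \<Rightarrow> real set" where
  "grid_boundary h N = {0, real N * h}"

definition norm_inf :: "real \<Rightarrow> nat \<Rightarrow> (real \<Rightarrow> real) \<Rightarrow> real" where
  "norm_inf h N w = Max ((\<lambda>x. \<bar>w x\<bar>) ` grid h N)"

definition norm_one :: "real \<Rightarrow> nat \<Rightarrow> (real \<Rightarrow> real) \<Rightarrow> real" where
  "norm_one h N w = (\<Sum>x\<in>grid h N. \<bar>w x\<bar>)"

definition diffusion :: "real \<Rightarrow> (real \<Rightarrow> real) \<Rightarrow> (real \<Rightarrow> real) \<Rightarrow> real \<Rightarrow> real" where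
  "diffusion h k w x =
     - (1 / h\<^sup>2) * k (x + h / 2) * (w (x + h) - w x)
     + (1 / h\<^sup>2) * k (x - h / 2) * (w x - w (x - h))"

definition conv_nondiv ::
  "real \<Rightarrow> (real \<Rightarrow> real \<Rightarrow> real) \<Rightarrow> real \<Rightarrow> (real \<Rightarrow> real) \<Rightarrow> real \<Rightarrow> real" where
  "conv_nondiv h v t w x =
     (1 / (2 * h)) * v (x + h / 2) t * (w (x + h) - w x)
     + (1 / (2 * h)) * v (x - h / 2) t * (w x - w (x - h))"

definition conv_div ::
  "real \<Rightarrow> (real \<Rightarrow> real \<Rightarrow> real) \<Rightarrow> real \<Rightarrow> (real \<Rightarrow> real) \<Rightarrow> real \<Rightarrow> real" where
  "conv_div h v t w x =
     (1 / (2 * h)) * v (x + h / 2) t * (w (x + h) + w x)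
     - (1 / (2 * h)) * v (x - h / 2) t * (w x + w (x - h))"

definition op_nondiv ::
  "real \<Rightarrow> (real \<Rightarrow> real) \<Rightarrow> (real \<Rightarrow> real \<Rightarrow> real) \<Rightarrow> real \<Rightarrow> (real \<Rightarrow> real) \<Rightarrow> real \<Rightarrow> real" where
  "op_nondiv h k v t w x = conv_nondiv h v t w x + diffusion h k w x"

definition op_div ::
  "real \<Rightarrow> (real \<Rightarrow> real) \<Rightarrow> (real \<Rightarrow> real \<Rightarrow> real) \<Rightarrow> real \<Rightarrow> (real \<Rightarrow> real) \<Rightarrow> real \<Rightarrow> real" where
  "op_div h k v t w x = conv_div h v t w x + diffusion h k w x"

definition gamma_nondiv ::
  "real \<Rightarrow> nat \<Rightarrow> (real \<Rightarrow> real) \<Rightarrow> (real \<Rightarrow> real \<Rightarrow> real) \<Rightarrow> real \<Rightarrow> real" where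
  "gamma_nondiv h N k v t =
     Max ((\<lambda>x. (1 / h\<^sup>2) * (k (x + h / 2) + k (x - h / 2))
               - (1 / (2 * h)) * (v (x + h / 2) t - v (x - h / 2) t)) ` grid h N)"

definition gamma_div ::
  "real \<Rightarrow> nat \<Rightarrow> (real \<Rightarrow> real) \<Rightarrow> (real \<Rightarrow> real \<Rightarrow> real) \<Rightarrow> real \<Rightarrow> real" where
  "gamma_div h N k v t =
     Max ((\<lambda>x. (1 / h\<^sup>2) * (k (x + h / 2) + k (x - h / 2))
               + (1 / (2 * h)) * (v (x + h / 2) t - v (x - h / 2) t)) ` grid h N)"

(* The steps from n * tau to (n + 1) * tau that stay within the time interval [0, T] on
   which the coefficient v is given. *)
definition time_steps :: "real \<Rightarrow> real \<Rightarrow> nat set" where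
  "time_steps T \<tau> = {n. real (n + 1) * \<tau> \<le> T}"

definition step_time :: "real \<Rightarrow> real \<Rightarrow> nat \<Rightarrow> real" where
  "step_time \<tau> \<sigma> n = \<sigma> * (real (n + 1) * \<tau>) + (1 - \<sigma>) * (real n * \<tau>)"

(* The guard makes the constraint void when gamma = 0, where 1 / 0 = 0 in HOL would
   otherwise exclude every positive time step. *)
definition step_constraint :: "real \<Rightarrow> real \<Rightarrow> real \<Rightarrow> (real \<Rightarrow> real) \<Rightarrow> bool" where
  "step_constraint T \<tau> \<sigma> \<gamma> \<longleftrightarrow>
     (\<forall>n\<in>time_steps T \<tau>. \<gamma> (step_time \<tau> \<sigma> n) \<noteq> 0 \<longrightarrow>
        \<tau> \<le> 1 / ((1 - \<sigma>) * \<gamma> (step_time \<tau> \<sigma> n)))"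

definition scheme_solution ::
  "real \<Rightarrow> nat \<Rightarrow> real \<Rightarrow> real \<Rightarrow> real \<Rightarrow> (real \<Rightarrow> (real \<Rightarrow> real) \<Rightarrow> real \<Rightarrow> real) \<Rightarrow>
   (real \<Rightarrow> real) \<Rightarrow> (nat \<Rightarrow> real \<Rightarrow> real) \<Rightarrow> (nat \<Rightarrow> real \<Rightarrow> real) \<Rightarrow> bool" where
  "scheme_solution h N T \<tau> \<sigma> A u0 \<phi> y \<longleftrightarrow>
     (\<forall>n. real n * \<tau> \<le> T \<longrightarrow> (\<forall>x\<in>grid_boundary h N. y n x = 0)) \<and>
     (\<forall>x\<in>grid h N. y 0 x = u0 x) \<and>
     (\<forall>n\<in>time_steps T \<tau>. \<forall>x\<in>grid h N.
        (y (n + 1) x - y n x) / \<tau>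
        + A (step_time \<tau> \<sigma> n) (\<lambda>z. \<sigma> * y (n + 1) z + (1 - \<sigma>) * y n z) x = \<phi> n x)"

definition scheme_monotone ::
  "real \<Rightarrow> nat \<Rightarrow> real \<Rightarrow> real \<Rightarrow> real \<Rightarrow> (real \<Rightarrow> (real \<Rightarrow> real) \<Rightarrow> real \<Rightarrow> real) \<Rightarrow> bool" where
  "scheme_monotone h N T \<tau> \<sigma> A \<longleftrightarrow>
     (\<forall>u0 \<phi> y. scheme_solution h N T \<tau> \<sigma> A u0 \<phi> y \<longrightarrow>
        (\<forall>x\<in>grid h N. u0 x \<ge> 0) \<longrightarrow>
        (\<forall>n\<in>time_steps T \<tau>. \<forall>x\<in>grid h N. \<phi> n x \<ge> 0) \<longrightarrow>
        (\<forall>n\<in>time_steps T \<tau>. \<forall>x\<in>grid h N. y (n + 1) x \<ge> 0))"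

end

(* Both operators have the form A w (x) = c x * w x - P (x - h/2) * w (x - h) - Q (x + h/2) * w (x + h)
   with P, Q >= 0.  In the nondivergent case the rows of A sum to zero, in the divergent case the
   columns do, up to boundary terms of the good sign.  Under the time-step constraint a sublinear
   function S of the solution is a subsolution of the scheme with right-hand side S(phi).  Row sums
   give a maximum principle for subsolutions, column sums an L1 estimate.  Taking S = abs yields
   stability; taking S to be the negative part yields monotonicity. *)

theory Submission
  imports Defs
begin

section \<open>Three-point operators and subsolutions\<close>

definition three_point ::
  "real \<Rightarrow> (real \<Rightarrow> real) \<Rightarrow> (real \<Rightarrow> real) \<Rightarrow> (real \<Rightarrow> real) \<Rightarrow> (real \<Rightarrow> real) \<Rightarrow> real \<Rightarrow> real" where
  "three_point h c P Q w x = c x * w x - P (x - h / 2) * w (x - h) - Q (x + h / 2) * w (x + h)"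

text \<open>Nonnegativity is built in so that the norms of \<open>w0\<close> and \<open>w1\<close>
  are a plain maximum and a plain sum, for which a one-sided inequality suffices.\<close>

definition subsolution_step ::
  "real \<Rightarrow> nat \<Rightarrow> real \<Rightarrow> real \<Rightarrow> ((real \<Rightarrow> real) \<Rightarrow> real \<Rightarrow> real) \<Rightarrow>
   (real \<Rightarrow> real) \<Rightarrow> (real \<Rightarrow> real) \<Rightarrow> (real \<Rightarrow> real) \<Rightarrow> bool" where
  "subsolution_step h N \<tau> \<sigma> A w0 w1 g \<longleftrightarrow>
     (\<forall>x\<in>grid_boundary h N. w0 x = 0 \<and> w1 x = 0) \<and>
     (\<forall>x\<in>grid h N. w0 x \<ge> 0 \<and> w1 x \<ge> 0 \<and>
        (w1 x - w0 x) / \<tau> + A (\<lambda>z. \<sigma> * w1 z + (1 - \<sigma>) * w0 z) x \<le> g x)"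

section \<open>Nodes, midpoints and shifted sums\<close>

lemma finite_grid [simp]: "finite (grid h N)"
  by (simp add: grid_def)

lemma grid_nonempty: "N \<ge> 2 \<Longrightarrow> grid h N \<noteq> {}"
  by (simp add: grid_def)

lemma grid_plus_step:
  assumes "x \<in> grid h N"
  shows "x + h \<in> grid h N \<union> grid_boundary h N"
proof -
  obtain i where i: "i \<in> {1..N - 1}" "x = real i * h"
    using assms by (auto simp: grid_def)
  then have xh: "x + h = real (Suc i) * h" by (simp add: algebra_simps)
  show ?thesis
  proof (cases "Suc i = N")
    case True
    with xh show ?thesis by (simp add: grid_boundary_def)
  next
    case False
    with i have "Suc i \<in> {1..N - 1}" by auto
    with xh show ?thesis unfolding grid_def by blast
  qed
qed

lemma grid_minus_step:
  assumes "x \<in> grid h N"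
  shows "x - h \<in> grid h N \<union> grid_boundary h N"
proof -
  obtain i where i: "i \<in> {1..N - 1}" "x = real i * h"
    using assms by (auto simp: grid_def)
  then obtain j where j: "i = Suc j" by (cases i) auto
  with i have xh: "x - h = real j * h" by (simp add: algebra_simps)
  show ?thesis
  proof (cases j)
    case 0
    with xh show ?thesis by (simp add: grid_boundary_def)
  next
    case (Suc m)
    with i j have "j \<in> {1..N - 1}" by auto
    with xh show ?thesis unfolding grid_def by blast
  qed
qed

text \<open>The lower bound on \<open>k\<close> is given on the closed interval only, so positivity
  at the midpoints rests on this.\<close>

lemma grid_half_step_bounds:
  assumes "x \<in> grid h N" "h > 0"
  shows "x + h / 2 \<in> {0..real N * h}" "x - h / 2 \<in> {0..real N * h}"
proof -
  obtain i where i: "1 \<le> i" "Suc i \<le> N" "x = real i * h"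
    using assms(1) by (fastforce simp: grid_def)
  have "1 * h \<le> real i * h" "real (Suc i) * h \<le> real N * h"
    using i assms(2) by (auto intro!: mult_right_mono)
  with i assms(2) show "x + h / 2 \<in> {0..real N * h}" "x - h / 2 \<in> {0..real N * h}"
    by (auto simp: algebra_simps)
qed

lemma sum_grid:
  assumes "h > 0" "N \<ge> 2"
  shows "(\<Sum>x\<in>grid h N. f x) = (\<Sum>i=1..<N. f (real i * h))"
proof -
  have "inj_on (\<lambda>i. real i * h) {1..N - 1}"
    using assms(1) by (auto simp: inj_on_def)
  moreover have "{1..N - 1} = {1..<N}" using assms(2) by auto
  ultimately show ?thesis by (simp add: grid_def sum.reindex)
qed

text \<open>The shift brings in the value at 0, which vanishes, and loses the value at the last
  inner node, which is nonnegative.\<close>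

lemma sum_grid_minus_step_le:
  assumes "h > 0" "N \<ge> 2" "f 0 = 0" "\<forall>x\<in>grid h N. f x \<ge> (0::real)"
  shows "(\<Sum>x\<in>grid h N. f (x - h)) \<le> (\<Sum>x\<in>grid h N. f x)"
proof -
  \<comment> \<open>The inner nodes have indices 1 to \<open>Suc M\<close>, so a first and a last
    one exist.\<close>
  obtain M where N: "N = Suc (Suc M)" using assms(2)
    by (metis One_nat_def Suc_1 Suc_le_D Suc_le_mono)
  have last: "f (real (Suc M) * h) \<ge> 0"
    using assms(4) unfolding grid_def N by (metis atLeastAtMost_iff diff_Suc_1 imageI le_add1 le_refl plus_1_eq_Suc)
  have "(\<Sum>x\<in>grid h N. f (x - h)) = (\<Sum>i=Suc 0..<Suc (Suc M). f (real i * h - h))"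
    using assms by (simp add: sum_grid N)
  also have "\<dots> = (\<Sum>i=0..<Suc M. f (real (Suc i) * h - h))"
    by (rule sum.shift_bounds_Suc_ivl)
  also have "\<dots> = (\<Sum>i=0..<Suc M. f (real i * h))"
    by (simp add: algebra_simps)
  also have "\<dots> = (\<Sum>i=Suc 0..<Suc M. f (real i * h))"
    using assms(3) by (subst sum.atLeast_Suc_lessThan) auto
  also have "\<dots> \<le> (\<Sum>i=Suc 0..<Suc (Suc M). f (real i * h))"
    using last by simp
  also have "\<dots> = (\<Sum>x\<in>grid h N. f x)"
    using assms by (simp add: sum_grid N)
  finally show ?thesis .
qed

text \<open>Mirror image of the previous lemma: the right boundary value enters, the value at the
  first inner node is lost.\<close>

lemma sum_grid_plus_step_le:
  assumes "h > 0" "N \<ge> 2" "f (real N * h) = 0" "\<forall>x\<in>grid h N. f x \<ge> (0::real)"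
  shows "(\<Sum>x\<in>grid h N. f (x + h)) \<le> (\<Sum>x\<in>grid h N. f x)"
proof -
  obtain M where N: "N = Suc (Suc M)" using assms(2)
    by (metis One_nat_def Suc_1 Suc_le_D Suc_le_mono)
  have first: "f (real (Suc 0) * h) \<ge> 0"
    using assms(4) unfolding grid_def N by (metis One_nat_def atLeastAtMost_iff diff_Suc_1 imageI le_add1 le_refl plus_1_eq_Suc)
  have "(\<Sum>x\<in>grid h N. f (x + h)) = (\<Sum>i=Suc 0..<Suc (Suc M). f (real (Suc i) * h))"
    using assms by (simp add: sum_grid N algebra_simps)
  also have "\<dots> = (\<Sum>i=Suc (Suc 0)..<Suc (Suc (Suc M)). f (real i * h))"
    by (rule sum.shift_bounds_Suc_ivl [symmetric])
  also have "\<dots> = (\<Sum>i=Suc (Suc 0)..<Suc (Suc M). f (real i * h))"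
    using assms(3) N by simp
  also have "\<dots> \<le> (\<Sum>i=Suc 0..<Suc (Suc M). f (real i * h))"
    using first by (subst (2) sum.atLeast_Suc_lessThan) auto
  also have "\<dots> = (\<Sum>x\<in>grid h N. f x)"
    using assms by (simp add: sum_grid N)
  finally show ?thesis .
qed

section \<open>One-step estimates for subsolutions\<close>

lemma abs_le_norm_inf: "x \<in> grid h N \<Longrightarrow> \<bar>w x\<bar> \<le> norm_inf h N w"
  by (simp add: norm_inf_def)

lemma norm_inf_attained:
  assumes "N \<ge> 2"
  obtains x where "x \<in> grid h N" "norm_inf h N w = \<bar>w x\<bar>"
proof -
  have "norm_inf h N w \<in> (\<lambda>x. \<bar>w x\<bar>) ` grid h N"
    unfolding norm_inf_def using assms by (intro Max_in) (auto simp: grid_nonempty)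
  then show ?thesis using that by auto
qed

text \<open>Discrete maximum principle, read off at a node \<open>x\<close> where \<open>w1\<close>
  is maximal. As the rows sum to zero, the operator there is at least \<open>c x\<close> times the
  gap between the weighted average at \<open>x\<close> and its upper bound \<open>R\<close>.\<close>

lemma subsolution_step_norm_inf_le:
  assumes "N \<ge> 2" "\<tau> > 0" "\<sigma> \<ge> 0" "\<sigma> \<le> 1"
    and sub: "subsolution_step h N \<tau> \<sigma> (three_point h c P Q) w0 w1 g"
    and nonneg: "\<forall>x\<in>grid h N. P (x - h / 2) \<ge> 0 \<and> Q (x + h / 2) \<ge> 0"
    and rows: "\<forall>x\<in>grid h N. c x = P (x - h / 2) + Q (x + h / 2)"
    and step: "\<forall>x\<in>grid h N. \<tau> * (1 - \<sigma>) * c x \<le> 1"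
  shows "norm_inf h N w1 \<le> norm_inf h N w0 + \<tau> * norm_inf h N g"
proof -
  obtain x where x: "x \<in> grid h N" and w1x: "norm_inf h N w1 = \<bar>w1 x\<bar>"
    using norm_inf_attained [OF \<open>N \<ge> 2\<close>] by blast
  define M1 M0 where "M1 = norm_inf h N w1" and "M0 = norm_inf h N w0"
  define a b where "a = P (x - h / 2)" and "b = Q (x + h / 2)"
  \<comment> \<open>Neighbours of \<open>x\<close> may be boundary nodes; the bounds extend there
    because the values are 0 and the norms nonnegative.\<close>
  have bd: "w1 z \<le> M1 \<and> w0 z \<le> M0" if "z \<in> grid h N \<union> grid_boundary h N" for z
  proof -
    have "0 \<le> M1" "0 \<le> M0"
      unfolding M1_def M0_def using abs_le_norm_inf [OF x] abs_ge_zero order_trans by blast+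
    moreover have "w1 z \<le> M1 \<and> w0 z \<le> M0" if "z \<in> grid h N"
      unfolding M1_def M0_def using abs_le_norm_inf [OF that] abs_le_D1 by blast
    ultimately show ?thesis
      using that sub by (auto simp: subsolution_step_def)
  qed
  have ab: "a \<ge> 0" "b \<ge> 0" and c: "c x = a + b"
    using x nonneg rows by (auto simp: a_def b_def)
  have eq1: "w1 x = M1"
    using x sub w1x by (simp add: subsolution_step_def M1_def)
  define W where "W = (\<lambda>z. \<sigma> * w1 z + (1 - \<sigma>) * w0 z)"
  define R where "R = \<sigma> * M1 + (1 - \<sigma>) * M0"
  have W_le: "W z \<le> R" if "z \<in> grid h N \<union> grid_boundary h N" for z
    unfolding W_def R_def using bd [OF that] assms(3,4)
    by (intro add_mono mult_left_mono) auto
  have "(M1 - w0 x) / \<tau> + ((a + b) * W x - a * W (x - h) - b * W (x + h)) \<le> g x"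
    using x sub eq1 c by (auto simp: subsolution_step_def three_point_def a_def b_def W_def)
  moreover have "a * W (x - h) \<le> a * R" "b * W (x + h) \<le> b * R"
    using ab W_le [OF grid_minus_step [OF x]] W_le [OF grid_plus_step [OF x]]
    by (auto intro: mult_left_mono)
  \<comment> \<open>Since \<open>w1 x\<close> equals \<open>M1\<close>, the implicit part of the gap
    cancels and only the explicit part, weighted by 1 - \<sigma>, is left.\<close>
  moreover have "R - W x = (1 - \<sigma>) * (M0 - w0 x)"
    unfolding R_def W_def eq1 by (simp add: algebra_simps)
  then have "(a + b) * R - (a + b) * W x = (a + b) * ((1 - \<sigma>) * (M0 - w0 x))"
    by (metis right_diff_distrib)
  moreover have "g x \<le> norm_inf h N g"
    using abs_le_norm_inf [OF x] abs_le_D1 by blast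
  ultimately have "(M1 - w0 x) / \<tau> \<le> norm_inf h N g + (a + b) * ((1 - \<sigma>) * (M0 - w0 x))"
    by (simp add: algebra_simps)
  then have "M1 - w0 x \<le> \<tau> * (norm_inf h N g + (a + b) * ((1 - \<sigma>) * (M0 - w0 x)))"
    using \<open>\<tau> > 0\<close> by (simp add: pos_divide_le_eq mult.commute)
  also have "\<dots> = \<tau> * norm_inf h N g + (\<tau> * (1 - \<sigma>) * c x) * (M0 - w0 x)"
    unfolding c by (simp add: algebra_simps)
  \<comment> \<open>The nonnegative gap \<open>M0 - w0 x\<close> has a factor at most 1 by the step
    constraint, so \<open>w0 x\<close> then cancels from both sides.\<close>
  also have "(\<tau> * (1 - \<sigma>) * c x) * (M0 - w0 x) \<le> 1 * (M0 - w0 x)"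
    using step x bd [of x] by (intro mult_right_mono) auto
  finally show ?thesis unfolding M1_def [symmetric] M0_def [symmetric] by simp
qed

text \<open>Collected by columns, \<open>w x\<close> receives \<open>c x\<close> from row
  \<open>x\<close>, \<open>- P (x + h / 2)\<close> from row \<open>x + h\<close> and
  \<open>- Q (x - h / 2)\<close> from row \<open>x - h\<close>, which add up to 0. Next to the
  boundary a row is missing, and with it a nonpositive entry.\<close>

lemma sum_three_point_nonneg:
  assumes "h > 0" "N \<ge> 2"
    and nonneg: "\<forall>x\<in>grid h N. P (x + h / 2) \<ge> 0 \<and> Q (x - h / 2) \<ge> 0"
    and columns: "\<forall>x\<in>grid h N. c x = P (x + h / 2) + Q (x - h / 2)"
    and w: "\<forall>x\<in>grid_boundary h N. w x = 0" "\<forall>x\<in>grid h N. w x \<ge> 0"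
  shows "(\<Sum>x\<in>grid h N. three_point h c P Q w x) \<ge> 0"
proof -
  have "(\<Sum>x\<in>grid h N. P (x - h + h / 2) * w (x - h)) \<le> (\<Sum>x\<in>grid h N. P (x + h / 2) * w x)"
    using assms by (intro sum_grid_minus_step_le) (auto simp: grid_boundary_def)
  moreover have "(\<Sum>x\<in>grid h N. Q (x + h - h / 2) * w (x + h)) \<le> (\<Sum>x\<in>grid h N. Q (x - h / 2) * w x)"
    using assms by (intro sum_grid_plus_step_le) (auto simp: grid_boundary_def)
  moreover have "x - h + h / 2 = x - h / 2" "x + h - h / 2 = x + h / 2" for x
    by simp_all
  moreover have "(\<Sum>x\<in>grid h N. c x * w x) =
      (\<Sum>x\<in>grid h N. P (x + h / 2) * w x) + (\<Sum>x\<in>grid h N. Q (x - h / 2) * w x)"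
    unfolding sum.distrib [symmetric]
    using columns by (intro sum.cong) (simp_all add: distrib_right)
  ultimately show ?thesis by (simp add: three_point_def sum_subtractf)
qed

text \<open>Summing the inequality over the grid gives the claim: the operator contributes a
  nonnegative sum, which is dropped, and the sums of \<open>w0\<close> and \<open>w1\<close> are
  their norms.\<close>

lemma subsolution_step_norm_one_le:
  assumes "h > 0" "N \<ge> 2" "\<tau> > 0" "\<sigma> \<ge> 0" "\<sigma> \<le> 1"
    and sub: "subsolution_step h N \<tau> \<sigma> (three_point h c P Q) w0 w1 g"
    and nonneg: "\<forall>x\<in>grid h N. P (x + h / 2) \<ge> 0 \<and> Q (x - h / 2) \<ge> 0"
    and columns: "\<forall>x\<in>grid h N. c x = P (x + h / 2) + Q (x - h / 2)"
  shows "norm_one h N w1 \<le> norm_one h N w0 + \<tau> * norm_one h N g"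
proof -
  define W where "W = (\<lambda>z. \<sigma> * w1 z + (1 - \<sigma>) * w0 z)"
  have "w1 x - w0 x \<le> \<tau> * \<bar>g x\<bar> - \<tau> * three_point h c P Q W x" if "x \<in> grid h N" for x
  proof -
    have "(w1 x - w0 x) / \<tau> \<le> \<bar>g x\<bar> - three_point h c P Q W x"
      using sub that by (fastforce simp: subsolution_step_def W_def)
    then have "w1 x - w0 x \<le> (\<bar>g x\<bar> - three_point h c P Q W x) * \<tau>"
      using \<open>\<tau> > 0\<close> by (simp add: pos_divide_le_eq)
    then show ?thesis by (simp add: algebra_simps)
  qed
  then have "(\<Sum>x\<in>grid h N. w1 x - w0 x) \<le>
      (\<Sum>x\<in>grid h N. \<tau> * \<bar>g x\<bar> - \<tau> * three_point h c P Q W x)"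
    by (rule sum_mono)
  moreover have "(\<Sum>x\<in>grid h N. three_point h c P Q W x) \<ge> 0"
    using assms by (intro sum_three_point_nonneg) (auto simp: W_def subsolution_step_def)
  moreover have "norm_one h N w1 = sum w1 (grid h N)" "norm_one h N w0 = sum w0 (grid h N)"
    using sub by (auto simp: norm_one_def subsolution_step_def intro!: sum.cong)
  ultimately show ?thesis
    using \<open>\<tau> > 0\<close> mult_nonneg_nonneg [of \<tau> "\<Sum>x\<in>grid h N. three_point h c P Q W x"]
    unfolding norm_one_def [of h N g] sum_subtractf sum_distrib_left [symmetric] by linarith
qed

section \<open>Sublinear functions of solutions\<close>

lemma sublinear_three_point_step:
  fixes S :: "real \<Rightarrow> real"
  assumes add: "\<And>s t. S (s + t) \<le> S s + S t"
    and scale: "\<And>\<alpha> t. \<alpha> \<ge> 0 \<Longrightarrow> S (\<alpha> * t) = \<alpha> * S t"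
    and "\<tau> > 0" "\<sigma> \<ge> 0" "\<sigma> \<le> 1"
    and coeffs: "P (x - h / 2) \<ge> 0" "Q (x + h / 2) \<ge> 0" "c x \<ge> 0" "\<tau> * (1 - \<sigma>) * c x \<le> 1"
    and eq: "(y1 x - y0 x) / \<tau> + three_point h c P Q (\<lambda>z. \<sigma> * y1 z + (1 - \<sigma>) * y0 z) x = f x"
  shows "(S (y1 x) - S (y0 x)) / \<tau>
    + three_point h c P Q (\<lambda>z. \<sigma> * S (y1 z) + (1 - \<sigma>) * S (y0 z)) x \<le> S (f x)"
proof -
  define a b where "a = P (x - h / 2)" and "b = Q (x + h / 2)"
  \<comment> \<open>\<open>d\<close> and \<open>e\<close> collect everything that multiplies
    \<open>y1 x\<close> and \<open>y0 x\<close>. The step constraint says precisely that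
    \<open>e\<close> is nonnegative.\<close>
  define e where "e = (1 - \<tau> * (1 - \<sigma>) * c x) / \<tau>"
  define d where "d = (1 + \<tau> * \<sigma> * c x) / \<tau>"
  have nonneg: "a \<ge> 0" "b \<ge> 0" "e \<ge> 0" "d \<ge> 0"
    using assms by (auto simp: a_def b_def e_def d_def)
  have split: "(p1 - p0) / \<tau> + c x * (\<sigma> * p1 + (1 - \<sigma>) * p0) = d * p1 - e * p0" for p0 p1
    using \<open>\<tau> > 0\<close> by (simp add: d_def e_def field_simps)
  let ?W = "\<lambda>z. \<sigma> * y1 z + (1 - \<sigma>) * y0 z"
  have conv: "S (?W z) \<le> \<sigma> * S (y1 z) + (1 - \<sigma>) * S (y0 z)" for z
    using add [of "\<sigma> * y1 z" "(1 - \<sigma>) * y0 z"] scale assms(4,5) by simp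
  \<comment> \<open>Solved for the new value at \<open>x\<close>, the scheme has only nonnegative
    coefficients on the right, so \<open>S\<close> can be pulled through by subadditivity and
    positive homogeneity.\<close>
  have "d * y1 x = e * y0 x + (a * ?W (x - h) + (b * ?W (x + h) + f x))"
    using eq split [of "y1 x" "y0 x"] by (simp add: three_point_def a_def b_def)
  then have "d * S (y1 x) = S (e * y0 x + (a * ?W (x - h) + (b * ?W (x + h) + f x)))"
    using scale nonneg by metis
  also have "\<dots> \<le> S (e * y0 x) + (S (a * ?W (x - h)) + (S (b * ?W (x + h)) + S (f x)))"
    by (intro order_trans [OF add] add_mono order_refl)
  also have "\<dots> = e * S (y0 x) + (a * S (?W (x - h)) + (b * S (?W (x + h)) + S (f x)))"
    using scale nonneg by simp
  also have "\<dots> \<le> e * S (y0 x) + (a * (\<sigma> * S (y1 (x - h)) + (1 - \<sigma>) * S (y0 (x - h)))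
      + (b * (\<sigma> * S (y1 (x + h)) + (1 - \<sigma>) * S (y0 (x + h))) + S (f x)))"
    using nonneg conv by (intro add_mono mult_left_mono) auto
  finally show ?thesis
    using split [of "S (y1 x)" "S (y0 x)"] by (simp add: three_point_def a_def b_def)
qed

text \<open>Common core of both cases, with the norm abstracted to \<nu>. Definiteness is stated
  with \<open>\<nu> w \<le> 0\<close> because the monotonicity argument yields just that upper
  bound.\<close>

lemma three_point_scheme_monotone_stable:
  fixes \<nu> :: "(real \<Rightarrow> real) \<Rightarrow> real"
  assumes \<tau>: "\<tau> > 0" and \<sigma>: "\<sigma> \<ge> 0" "\<sigma> \<le> 1"
    and A: "\<And>t w x. A t w x = three_point h (c t) (P t) (Q t) w x"
    and coeffs: "\<And>n x. \<lbrakk>n \<in> time_steps T \<tau>; x \<in> grid h N\<rbrakk> \<Longrightarrow>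
        P (step_time \<tau> \<sigma> n) (x - h / 2) \<ge> 0 \<and> Q (step_time \<tau> \<sigma> n) (x + h / 2) \<ge> 0 \<and>
        c (step_time \<tau> \<sigma> n) x \<ge> 0 \<and> \<tau> * (1 - \<sigma>) * c (step_time \<tau> \<sigma> n) x \<le> 1"
    and estimate: "\<And>n w0 w1 g. \<lbrakk>n \<in> time_steps T \<tau>;
        subsolution_step h N \<tau> \<sigma> (A (step_time \<tau> \<sigma> n)) w0 w1 g\<rbrakk> \<Longrightarrow> \<nu> w1 \<le> \<nu> w0 + \<tau> * \<nu> g"
    and \<nu>_cong: "\<And>w w'. \<forall>x\<in>grid h N. \<bar>w x\<bar> = \<bar>w' x\<bar> \<Longrightarrow> \<nu> w = \<nu> w'"
    and \<nu>_zero: "\<nu> (\<lambda>_. 0) = 0"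
    and \<nu>_definite: "\<And>w x. \<lbrakk>\<nu> w \<le> 0; x \<in> grid h N\<rbrakk> \<Longrightarrow> w x = 0"
  shows "scheme_monotone h N T \<tau> \<sigma> A \<and>
    (\<forall>u0 \<phi> y. scheme_solution h N T \<tau> \<sigma> A u0 \<phi> y \<longrightarrow>
       (\<forall>n\<in>time_steps T \<tau>. \<nu> (y (n + 1)) \<le> \<nu> u0 + (\<Sum>j=0..n. \<tau> * \<nu> (\<phi> j))))"
proof -
  \<comment> \<open>Boundary values are prescribed only at times up to \<open>T\<close>, so the old
    time level has to be checked too.\<close>
  have before: "real n * \<tau> \<le> T" if "n \<in> time_steps T \<tau>" for n
    using that \<tau> by (simp add: time_steps_def algebra_simps)
  have step: "\<nu> (\<lambda>x. S (y (Suc n) x)) \<le> \<nu> (\<lambda>x. S (y n x)) + \<tau> * \<nu> (\<lambda>x. S (\<phi> n x))"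
    if sol: "scheme_solution h N T \<tau> \<sigma> A u0 \<phi> y" and n: "n \<in> time_steps T \<tau>"
      and add: "\<And>s t. S (s + t) \<le> S s + S t"
      and scale: "\<And>\<alpha> t. \<alpha> \<ge> 0 \<Longrightarrow> S (\<alpha> * t) = \<alpha> * S t"
      and pos: "\<And>t. S t \<ge> 0"
    for S :: "real \<Rightarrow> real" and u0 \<phi> y n
  proof (rule estimate [OF n])
    \<comment> \<open>Homogeneity with factor 0 keeps the boundary values zero under
      \<open>S\<close>.\<close>
    have "S 0 = 0" using scale [of 0 0] by simp
    then have "\<forall>x\<in>grid_boundary h N. S (y n x) = 0 \<and> S (y (Suc n) x) = 0"
      using sol n before [OF n] by (auto simp: scheme_solution_def time_steps_def)
    moreover have "(S (y (Suc n) x) - S (y n x)) / \<tau>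
        + A (step_time \<tau> \<sigma> n) (\<lambda>z. \<sigma> * S (y (Suc n) z) + (1 - \<sigma>) * S (y n z)) x \<le> S (\<phi> n x)"
      if x: "x \<in> grid h N" for x
      unfolding A using coeffs [OF n x] sol n x
      by (intro sublinear_three_point_step [OF add scale \<tau> \<sigma>]) (auto simp: scheme_solution_def A)
    ultimately show "subsolution_step h N \<tau> \<sigma> (A (step_time \<tau> \<sigma> n))
        (\<lambda>x. S (y n x)) (\<lambda>x. S (y (Suc n) x)) (\<lambda>x. S (\<phi> n x))"
      using pos by (simp add: subsolution_step_def)
  qed
  have initial: "\<nu> (\<lambda>x. S (y 0 x)) = \<nu> (\<lambda>x. S (u0 x))"
    if "scheme_solution h N T \<tau> \<sigma> A u0 \<phi> y" for S :: "real \<Rightarrow> real" and u0 \<phi> y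
    using that by (intro \<nu>_cong) (auto simp: scheme_solution_def)
  \<comment> \<open>Induction on the step number needs the admissible steps to be closed
    downwards.\<close>
  have pred: "n \<in> time_steps T \<tau>" if "Suc n \<in> time_steps T \<tau>" for n
    using that \<tau> by (simp add: time_steps_def algebra_simps)
  have bound: "\<nu> (\<lambda>x. S (y (Suc n) x)) \<le> \<nu> (\<lambda>x. S (u0 x)) + (\<Sum>j=0..n. \<tau> * \<nu> (\<lambda>x. S (\<phi> j x)))"
    if sol: "scheme_solution h N T \<tau> \<sigma> A u0 \<phi> y"
      and add: "\<And>s t. S (s + t) \<le> S s + S t"
      and scale: "\<And>\<alpha> t. \<alpha> \<ge> 0 \<Longrightarrow> S (\<alpha> * t) = \<alpha> * S t"
      and pos: "\<And>t. S t \<ge> 0"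
      and n: "n \<in> time_steps T \<tau>"
    for S :: "real \<Rightarrow> real" and u0 \<phi> y n
    using n
  proof (induction n)
    case 0
    then show ?case
      using step [of u0 \<phi> y 0 S, OF sol _ add scale pos] initial [OF sol, of S] by simp
  next
    case (Suc n)
    then show ?case
      using step [of u0 \<phi> y "Suc n" S, OF sol _ add scale pos] pred [of n] by simp
  qed
  have "scheme_monotone h N T \<tau> \<sigma> A"
    unfolding scheme_monotone_def
  proof (intro allI impI ballI)
    fix u0 \<phi> y n x
    assume sol: "scheme_solution h N T \<tau> \<sigma> A u0 \<phi> y"
      and u0: "\<forall>x\<in>grid h N. u0 x \<ge> 0"
      and \<phi>: "\<forall>n\<in>time_steps T \<tau>. \<forall>x\<in>grid h N. \<phi> n x \<ge> 0"
      and n: "n \<in> time_steps T \<tau>" and x: "x \<in> grid h N"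
    \<comment> \<open>The negative part vanishes exactly on nonnegative numbers. It annihilates the
      data, so the bound forces it to vanish on the solution.\<close>
    define S :: "real \<Rightarrow> real" where "S = (\<lambda>t. max 0 (- t))"
    have add: "S (s + t) \<le> S s + S t" for s t by (auto simp: S_def)
    have scale: "S (\<alpha> * t) = \<alpha> * S t" if "\<alpha> \<ge> 0" for \<alpha> t
      using that max_mult_distrib_left [of \<alpha> 0 "- t"] by (simp add: S_def)
    have pos: "S t \<ge> 0" for t by (simp add: S_def)
    have "\<nu> (\<lambda>x. S (\<phi> j x)) = 0" if "j \<le> n" for j
    proof -
      have "real (j + 1) * \<tau> \<le> real (n + 1) * \<tau>"
        using that \<tau> by (intro mult_right_mono) auto
      with n have "j \<in> time_steps T \<tau>" by (simp add: time_steps_def)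
      with \<phi> have "\<nu> (\<lambda>x. S (\<phi> j x)) = \<nu> (\<lambda>_. 0)"
        by (intro \<nu>_cong) (auto simp: S_def)
      then show ?thesis by (simp add: \<nu>_zero)
    qed
    moreover have "\<nu> (\<lambda>x. S (u0 x)) = \<nu> (\<lambda>_. 0)"
      using u0 by (intro \<nu>_cong) (auto simp: S_def)
    ultimately have "\<nu> (\<lambda>x. S (y (Suc n) x)) \<le> 0"
      using bound [OF sol add scale pos n] by (simp add: \<nu>_zero)
    then have "S (y (Suc n) x) = 0" using \<nu>_definite x by blast
    then show "y (n + 1) x \<ge> 0" by (simp add: S_def max_def split: if_splits)
  qed
  moreover have "\<nu> (y (n + 1)) \<le> \<nu> u0 + (\<Sum>j=0..n. \<tau> * \<nu> (\<phi> j))"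
    if "scheme_solution h N T \<tau> \<sigma> A u0 \<phi> y" "n \<in> time_steps T \<tau>" for u0 \<phi> y n
  proof -
    \<comment> \<open>As \<nu> sees absolute values only, the bound for \<open>S = abs\<close> is
      already the stability estimate.\<close>
    have "\<nu> (\<lambda>x. \<bar>w x\<bar>) = \<nu> w" for w by (rule \<nu>_cong) simp
    then show ?thesis
      using bound [where S = abs, OF that(1) abs_triangle_ineq _ abs_ge_zero that(2)]
      by (simp add: abs_mult)
  qed
  ultimately show ?thesis by blast
qed

section \<open>Coefficients of the two difference operators\<close>

definition left_coeff :: "real \<Rightarrow> (real \<Rightarrow> real) \<Rightarrow> (real \<Rightarrow> real \<Rightarrow> real) \<Rightarrow> real \<Rightarrow> real \<Rightarrow> real" where
  "left_coeff h k v t z = (1 / h\<^sup>2) * k z + (1 / (2 * h)) * v z t"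

definition right_coeff :: "real \<Rightarrow> (real \<Rightarrow> real) \<Rightarrow> (real \<Rightarrow> real \<Rightarrow> real) \<Rightarrow> real \<Rightarrow> real \<Rightarrow> real" where
  "right_coeff h k v t z = (1 / h\<^sup>2) * k z - (1 / (2 * h)) * v z t"

text \<open>Only differences of \<open>w\<close> occur, so constants are annihilated and the
  diagonal entry is \<open>P (x - h / 2) + Q (x + h / 2)\<close>.\<close>

lemma op_nondiv_eq_three_point:
  "op_nondiv h k v t w x = three_point h
     (\<lambda>x. left_coeff h k v t (x - h / 2) + right_coeff h k v t (x + h / 2))
     (left_coeff h k v t) (right_coeff h k v t) w x"
proof -
  \<comment> \<open>With the reciprocals named, the identity is polynomial and ring normalisation
    settles it.\<close>
  define p q where "p = 1 / h\<^sup>2" and "q = 1 / (2 * h)"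
  show ?thesis
    unfolding op_nondiv_def conv_nondiv_def diffusion_def three_point_def left_coeff_def right_coeff_def
      p_def [symmetric] q_def [symmetric]
    by (simp add: algebra_simps)
qed

text \<open>The operator is the difference of the fluxes
  \<open>P z * w (z - h / 2) - Q z * w (z + h / 2)\<close> at \<open>z = x + h / 2\<close> and
  \<open>z = x - h / 2\<close>. Hence the diagonal uses the opposite midpoints to the nondivergent
  case.\<close>

lemma op_div_eq_three_point:
  "op_div h k v t w x = three_point h
     (\<lambda>x. left_coeff h k v t (x + h / 2) + right_coeff h k v t (x - h / 2))
     (left_coeff h k v t) (right_coeff h k v t) w x"
proof -
  define p q where "p = 1 / h\<^sup>2" and "q = 1 / (2 * h)"
  show ?thesis
    unfolding op_div_def conv_div_def diffusion_def three_point_def left_coeff_def right_coeff_def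
      p_def [symmetric] q_def [symmetric]
    by (simp add: algebra_simps)
qed

text \<open>The mesh condition amounts to convection being dominated by diffusion at the midpoint:
  \<open>\<bar>v z t\<bar> / (2 * h) \<le> k z / h\<^sup>2\<close>.\<close>

lemma coeffs_nonneg:
  assumes "h > 0" "k z > 0" "h * \<bar>v z t\<bar> / k z \<le> 2"
  shows "left_coeff h k v t z \<ge> 0" "right_coeff h k v t z \<ge> 0"
proof -
  have "h * \<bar>v z t\<bar> \<le> 2 * k z"
    using assms by (simp add: pos_divide_le_eq)
  then have "\<bar>v z t\<bar> / (2 * h) \<le> k z / h\<^sup>2"
    using assms(1) by (simp add: divide_simps power2_eq_square algebra_simps)
  moreover have "\<bar>v z t / (2 * h)\<bar> = \<bar>v z t\<bar> / (2 * h)"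
    using assms(1) by (simp add: abs_divide)
  ultimately show "left_coeff h k v t z \<ge> 0" "right_coeff h k v t z \<ge> 0"
    by (auto simp: left_coeff_def right_coeff_def abs_le_iff simp del: abs_divide)
qed

text \<open>Identifies \<gamma> as the largest diagonal entry of the three-point form.\<close>

lemma gamma_nondiv_ge:
  assumes "x \<in> grid h N"
  shows "left_coeff h k v t (x - h / 2) + right_coeff h k v t (x + h / 2) \<le> gamma_nondiv h N k v t"
proof -
  have "left_coeff h k v t (x - h / 2) + right_coeff h k v t (x + h / 2) =
      (1 / h\<^sup>2) * (k (x + h / 2) + k (x - h / 2)) - (1 / (2 * h)) * (v (x + h / 2) t - v (x - h / 2) t)"
    unfolding left_coeff_def right_coeff_def by algebra
  then show ?thesis unfolding gamma_nondiv_def using assms by (auto intro!: Max_ge)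
qed

lemma gamma_div_ge:
  assumes "x \<in> grid h N"
  shows "left_coeff h k v t (x + h / 2) + right_coeff h k v t (x - h / 2) \<le> gamma_div h N k v t"
proof -
  have "left_coeff h k v t (x + h / 2) + right_coeff h k v t (x - h / 2) =
      (1 / h\<^sup>2) * (k (x + h / 2) + k (x - h / 2)) + (1 / (2 * h)) * (v (x + h / 2) t - v (x - h / 2) t)"
    unfolding left_coeff_def right_coeff_def by algebra
  then show ?thesis unfolding gamma_div_def using assms by (auto intro!: Max_ge)
qed

lemma step_constraintD:
  assumes "\<sigma> = 1 \<or> 0 \<le> \<sigma> \<and> \<sigma> < 1 \<and> step_constraint T \<tau> \<sigma> \<gamma>"
    and "n \<in> time_steps T \<tau>" "\<tau> > 0" "0 \<le> c" "c \<le> \<gamma> (step_time \<tau> \<sigma> n)"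
  shows "\<tau> * (1 - \<sigma>) * c \<le> 1"
\<comment> \<open>In both excluded cases the product is 0. Otherwise \<gamma> is at least
  \<open>c > 0\<close>, so the guard in \<open>step_constraint\<close> holds and the denominator is
  positive.\<close>
proof (cases "\<sigma> = 1 \<or> c = 0")
  case False
  define G where "G = \<gamma> (step_time \<tau> \<sigma> n)"
  have G: "G > 0" and \<sigma>: "\<sigma> < 1" using False assms by (auto simp: G_def)
  then have "\<tau> \<le> 1 / ((1 - \<sigma>) * G)"
    using assms by (auto simp: step_constraint_def G_def)
  then have "\<tau> * ((1 - \<sigma>) * G) \<le> 1"
    using G \<sigma> by (simp add: pos_le_divide_eq)
  moreover have "\<tau> * (1 - \<sigma>) * c \<le> \<tau> * (1 - \<sigma>) * G"
    using assms \<sigma> by (intro mult_left_mono) (auto simp: G_def)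
  ultimately show ?thesis by (simp add: mult.assoc)
qed auto

section \<open>Monotonicity and stability of the two schemes\<close>

theorem theorem25:
  fixes N :: nat and h l T \<tau> \<sigma> \<kappa>\<^sub>1 :: real
    and k :: "real \<Rightarrow> real" and v :: "real \<Rightarrow> real \<Rightarrow> real"
  assumes "N \<ge> 2" and "h > 0" and "real N * h = l" and "\<tau> > 0"
    and "\<kappa>\<^sub>1 > 0" and "\<forall>x\<in>{0..l}. k x \<ge> \<kappa>\<^sub>1"
    and "\<forall>n\<in>time_steps T \<tau>. \<forall>x\<in>grid h N.
           h * \<bar>v (x + h / 2) (step_time \<tau> \<sigma> n)\<bar> / k (x + h / 2) \<le> 2 \<and>
           h * \<bar>v (x - h / 2) (step_time \<tau> \<sigma> n)\<bar> / k (x - h / 2) \<le> 2"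
  shows "(\<sigma> = 1 \<or> 0 \<le> \<sigma> \<and> \<sigma> < 1 \<and> step_constraint T \<tau> \<sigma> (gamma_nondiv h N k v) \<longrightarrow>
           scheme_monotone h N T \<tau> \<sigma> (op_nondiv h k v) \<and>
           (\<forall>u0 \<phi> y. scheme_solution h N T \<tau> \<sigma> (op_nondiv h k v) u0 \<phi> y \<longrightarrow>
              (\<forall>n\<in>time_steps T \<tau>.
                 norm_inf h N (y (n + 1)) \<le> norm_inf h N u0 + (\<Sum>j=0..n. \<tau> * norm_inf h N (\<phi> j))))) \<and>
         (\<sigma> = 1 \<or> 0 \<le> \<sigma> \<and> \<sigma> < 1 \<and> step_constraint T \<tau> \<sigma> (gamma_div h N k v) \<longrightarrow>
           scheme_monotone h N T \<tau> \<sigma> (op_div h k v) \<and>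
           (\<forall>u0 \<phi> y. scheme_solution h N T \<tau> \<sigma> (op_div h k v) u0 \<phi> y \<longrightarrow>
              (\<forall>n\<in>time_steps T \<tau>.
                 norm_one h N (y (n + 1)) \<le> norm_one h N u0 + (\<Sum>j=0..n. \<tau> * norm_one h N (\<phi> j)))))"
proof -
  let ?P = "left_coeff h k v" and ?Q = "right_coeff h k v"
  \<comment> \<open>Both coefficients are needed at both midpoints: row sums pair \<open>P\<close>
    at the left with \<open>Q\<close> at the right one, column sums the other way round.\<close>
  have coeffs: "?P (step_time \<tau> \<sigma> n) (x + h / 2) \<ge> 0 \<and> ?Q (step_time \<tau> \<sigma> n) (x + h / 2) \<ge> 0 \<and>
      ?P (step_time \<tau> \<sigma> n) (x - h / 2) \<ge> 0 \<and> ?Q (step_time \<tau> \<sigma> n) (x - h / 2) \<ge> 0"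
    if "n \<in> time_steps T \<tau>" "x \<in> grid h N" for n x
  proof -
    have "k (x + h / 2) > 0" "k (x - h / 2) > 0"
      using grid_half_step_bounds [OF that(2) assms(2)] assms(3,5,6) by fastforce+
    with that assms(2,7) show ?thesis by (simp add: coeffs_nonneg)
  qed
  have nondiv: "scheme_monotone h N T \<tau> \<sigma> (op_nondiv h k v) \<and>
      (\<forall>u0 \<phi> y. scheme_solution h N T \<tau> \<sigma> (op_nondiv h k v) u0 \<phi> y \<longrightarrow>
         (\<forall>n\<in>time_steps T \<tau>.
            norm_inf h N (y (n + 1)) \<le> norm_inf h N u0 + (\<Sum>j=0..n. \<tau> * norm_inf h N (\<phi> j))))"
    if step: "\<sigma> = 1 \<or> 0 \<le> \<sigma> \<and> \<sigma> < 1 \<and> step_constraint T \<tau> \<sigma> (gamma_nondiv h N k v)"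
  proof -
    let ?c = "\<lambda>t x. ?P t (x - h / 2) + ?Q t (x + h / 2)"
    have \<sigma>: "\<sigma> \<ge> 0" "\<sigma> \<le> 1" using step by auto
    have c: "?c (step_time \<tau> \<sigma> n) x \<ge> 0 \<and> \<tau> * (1 - \<sigma>) * ?c (step_time \<tau> \<sigma> n) x \<le> 1"
      if "n \<in> time_steps T \<tau>" "x \<in> grid h N" for n x
      using coeffs [OF that] step_constraintD [OF step that(1) \<open>\<tau> > 0\<close> _ gamma_nondiv_ge [OF that(2)]]
      by simp
    show ?thesis
    proof (rule three_point_scheme_monotone_stable [where c = ?c and P = ?P and Q = ?Q, OF \<open>\<tau> > 0\<close> \<sigma>])
      show "norm_inf h N w1 \<le> norm_inf h N w0 + \<tau> * norm_inf h N g"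
        if "n \<in> time_steps T \<tau>"
          "subsolution_step h N \<tau> \<sigma> (op_nondiv h k v (step_time \<tau> \<sigma> n)) w0 w1 g" for n w0 w1 g
        using that coeffs c
        by (intro subsolution_step_norm_inf_le [where c = "?c (step_time \<tau> \<sigma> n)"
              and P = "?P (step_time \<tau> \<sigma> n)" and Q = "?Q (step_time \<tau> \<sigma> n)", OF \<open>N \<ge> 2\<close> \<open>\<tau> > 0\<close> \<sigma>])
          (auto simp: subsolution_step_def op_nondiv_eq_three_point)
      show "norm_inf h N w = norm_inf h N w'" if "\<forall>x\<in>grid h N. \<bar>w x\<bar> = \<bar>w' x\<bar>" for w w'
        using that by (simp add: norm_inf_def cong: image_cong)
      show "norm_inf h N (\<lambda>_. 0) = 0"
        \<comment> \<open>The maximum is attained at some node, as \<open>N \<ge> 2\<close> makes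
          the grid nonempty.\<close>
        using norm_inf_attained [OF \<open>N \<ge> 2\<close>, of h "\<lambda>_. 0"] by auto
      show "w x = 0" if "norm_inf h N w \<le> 0" "x \<in> grid h N" for w x
        using that abs_le_norm_inf [of x h N w] by simp
    qed (use coeffs c op_nondiv_eq_three_point in blast)+
  qed
  have "scheme_monotone h N T \<tau> \<sigma> (op_div h k v) \<and>
      (\<forall>u0 \<phi> y. scheme_solution h N T \<tau> \<sigma> (op_div h k v) u0 \<phi> y \<longrightarrow>
         (\<forall>n\<in>time_steps T \<tau>.
            norm_one h N (y (n + 1)) \<le> norm_one h N u0 + (\<Sum>j=0..n. \<tau> * norm_one h N (\<phi> j))))"
    if step: "\<sigma> = 1 \<or> 0 \<le> \<sigma> \<and> \<sigma> < 1 \<and> step_constraint T \<tau> \<sigma> (gamma_div h N k v)"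
  proof -
    let ?c = "\<lambda>t x. ?P t (x + h / 2) + ?Q t (x - h / 2)"
    have \<sigma>: "\<sigma> \<ge> 0" "\<sigma> \<le> 1" using step by auto
    have c: "?c (step_time \<tau> \<sigma> n) x \<ge> 0 \<and> \<tau> * (1 - \<sigma>) * ?c (step_time \<tau> \<sigma> n) x \<le> 1"
      if "n \<in> time_steps T \<tau>" "x \<in> grid h N" for n x
      using coeffs [OF that] step_constraintD [OF step that(1) \<open>\<tau> > 0\<close> _ gamma_div_ge [OF that(2)]]
      by simp
    show ?thesis
    proof (rule three_point_scheme_monotone_stable [where c = ?c and P = ?P and Q = ?Q, OF \<open>\<tau> > 0\<close> \<sigma>])
      show "norm_one h N w1 \<le> norm_one h N w0 + \<tau> * norm_one h N g"
        if "n \<in> time_steps T \<tau>"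
          "subsolution_step h N \<tau> \<sigma> (op_div h k v (step_time \<tau> \<sigma> n)) w0 w1 g" for n w0 w1 g
        using that coeffs
        by (intro subsolution_step_norm_one_le [where c = "?c (step_time \<tau> \<sigma> n)"
              and P = "?P (step_time \<tau> \<sigma> n)" and Q = "?Q (step_time \<tau> \<sigma> n)",
              OF \<open>h > 0\<close> \<open>N \<ge> 2\<close> \<open>\<tau> > 0\<close> \<sigma>])
          (auto simp: subsolution_step_def op_div_eq_three_point)
      show "norm_one h N w = norm_one h N w'" if "\<forall>x\<in>grid h N. \<bar>w x\<bar> = \<bar>w' x\<bar>" for w w'
        using that by (simp add: norm_one_def)
      show "norm_one h N (\<lambda>_. 0) = 0"
        by (simp add: norm_one_def)
      show "w x = 0" if "norm_one h N w \<le> 0" "x \<in> grid h N" for w x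
        using that member_le_sum [of x "grid h N" "\<lambda>x. \<bar>w x\<bar>"] by (simp add: norm_one_def)
    qed (use coeffs c op_div_eq_three_point in blast)+
  qed
  with nondiv show ?thesis by blast
qed

end
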